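(* The reduced Kepler problem is isomorphic to the coupled angular momenta with $R_1=R_2$. That is: for all $n,c>0$, the system $(\mathbb{S}^2\times\mathbb{S}^2,\omega_K,(L_z,G))$ given by $\omega_K=-n(\omega_{\mathbb{S}^2}\oplus\omega_{\mathbb{S}^2})$ and $$L_z=n(z_1+z_2),\qquad G=(x_1x_2+y_1y_2+z_1z_2)+c\,(z_1-z_2)$$ is isomorphic, as a semitoric system, to the coupled angular momenta system with $R_1=R_2=n$ for a suitable value of the parameter $t$.
   Context: $(x_i,y_i,z_i)$ are Cartesian coordinates on the $i$-th unit sphere, and $\omega_{\mathbb{S}^2}$ is the standard area form of the unit sphere. The system $(L_z,G)$ is the reduced Kepler problem (the Kepler problem in prolate spheroidal coordinates after symplectic reduction by the Hamiltonian flow). The coupled angular momenta system with parameters $R_1,R_2>0$, $t\in[0,1]$ is $\mathbb{S}^2\times\mathbb{S}^2$ with $\omega=-(R_1\omega_{\mathbb{S}^2}\oplus R_2\omega_{\mathbb{S}^2})$ and $$L=R_1(z_1-1)+R_2(z_2+1),\qquad H=(1-t)z_1+t(x_1x_2+y_1y_2+z_1z_2)+2t-1 .$$ Two systems $(M_1,\omega_1,(L_1,H_1))$ and $(M_2,\omega_2,(L_2,H_2))$ are isomorphic as semitoric systems if there are a symplectomorphism $\psi:M_1\to M_2$ and a smooth map $g:\mathbb{R}^2\to\mathbb{R}$ with $\psi^*(L_2,H_2)=(L_1,g(L_1,H_1))$ and $\partial g/\partial H_1>0$. *)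

theory Defs
  imports "HOL-Analysis.Analysis"
begin

text \<open>
  Manifolds are embedded submanifolds of a Euclidean space, given as subsets of the ambient type.
\<close>

fun higher_differentiable_on ::
  "'a::euclidean_space set \<Rightarrow> ('a \<Rightarrow> 'b::euclidean_space) \<Rightarrow> nat \<Rightarrow> bool" where
  "higher_differentiable_on U f 0 \<longleftrightarrow> continuous_on U f"
| "higher_differentiable_on U f (Suc k) \<longleftrightarrow>
     (\<forall>x\<in>U. f differentiable (at x)) \<and>
     (\<forall>v. higher_differentiable_on U (\<lambda>x. frechet_derivative f (at x) v) k)"

text \<open>\<open>C\<^sup>\<infinity>\<close>; only meaningful for open \<open>U\<close>.\<close>

definition smooth_on ::
  "'a::euclidean_space set \<Rightarrow> ('a \<Rightarrow> 'b::euclidean_space) \<Rightarrow> bool" where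
  "smooth_on U f \<longleftrightarrow> (\<forall>k. higher_differentiable_on U f k)"

text \<open>Smoothness on an embedded submanifold: local existence of smooth extensions to the
  ambient space.\<close>

definition smooth_map ::
  "'a::euclidean_space set \<Rightarrow> 'b::euclidean_space set \<Rightarrow> ('a \<Rightarrow> 'b) \<Rightarrow> bool" where
  "smooth_map M N f \<longleftrightarrow> f ` M \<subseteq> N \<and>
     (\<forall>p\<in>M. \<exists>U F. open U \<and> p \<in> U \<and> smooth_on U F \<and> (\<forall>x\<in>M \<inter> U. F x = f x))"

definition diffeomorphism ::
  "'a::euclidean_space set \<Rightarrow> 'b::euclidean_space set \<Rightarrow> ('a \<Rightarrow> 'b) \<Rightarrow> bool" where
  "diffeomorphism M N f \<longleftrightarrow>
     bij_betw f M N \<and> smooth_map M N f \<and> smooth_map N M (inv_into M f)"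

definition tangent_space :: "'a::euclidean_space set \<Rightarrow> 'a \<Rightarrow> 'a set" where
  "tangent_space M p =
     {v. \<exists>e>0. \<exists>\<gamma> :: real \<Rightarrow> 'a. smooth_on {-e<..<e} \<gamma> \<and> \<gamma> ` {-e<..<e} \<subseteq> M \<and>
           \<gamma> 0 = p \<and> (\<gamma> has_vector_derivative v) (at 0)}"

text \<open>
  A two-form assigns to a base point a bilinear form; only its values on tangent vectors matter.
  A derivative \<open>D\<close> of \<open>\<psi>\<close> at \<open>p\<close> within \<open>M\<close> is uniquely determined on \<open>tangent_space M p\<close>, where it
  is the tangent map of \<open>\<psi>\<close>, so the existential quantifier below says that the pullback of
  \<open>\<omega>'\<close> is \<open>\<omega>\<close>.
\<close>

definition symplectomorphism ::
  "'a::euclidean_space set \<Rightarrow> ('a \<Rightarrow> 'a \<Rightarrow> 'a \<Rightarrow> real) \<Rightarrow>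
   'b::euclidean_space set \<Rightarrow> ('b \<Rightarrow> 'b \<Rightarrow> 'b \<Rightarrow> real) \<Rightarrow> ('a \<Rightarrow> 'b) \<Rightarrow> bool" where
  "symplectomorphism M \<omega> M' \<omega>' \<psi> \<longleftrightarrow> diffeomorphism M M' \<psi> \<and>
     (\<forall>p\<in>M. \<exists>D. (\<psi> has_derivative D) (at p within M) \<and>
        (\<forall>u\<in>tangent_space M p. \<forall>v\<in>tangent_space M p. \<omega>' (\<psi> p) (D u) (D v) = \<omega> p u v))"

text \<open>A system \<open>(M, \<omega>, (L, H))\<close>.\<close>

type_synonym 'a system = "'a set \<times> ('a \<Rightarrow> 'a \<Rightarrow> 'a \<Rightarrow> real) \<times> (('a \<Rightarrow> real) \<times> ('a \<Rightarrow> real))"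

definition semitoric_isomorphic ::
  "'a::euclidean_space system \<Rightarrow> 'b::euclidean_space system \<Rightarrow> bool" where
  "semitoric_isomorphic S\<^sub>1 S\<^sub>2 \<longleftrightarrow>
     (case S\<^sub>1 of (M\<^sub>1, \<omega>\<^sub>1, (L\<^sub>1, H\<^sub>1)) \<Rightarrow> case S\<^sub>2 of (M\<^sub>2, \<omega>\<^sub>2, (L\<^sub>2, H\<^sub>2)) \<Rightarrow>
       \<exists>\<psi> (g :: real \<times> real \<Rightarrow> real).
         symplectomorphism M\<^sub>1 \<omega>\<^sub>1 M\<^sub>2 \<omega>\<^sub>2 \<psi> \<and> smooth_on UNIV g \<and>
         (\<forall>p\<in>M\<^sub>1. L\<^sub>2 (\<psi> p) = L\<^sub>1 p \<and> H\<^sub>2 (\<psi> p) = g (L\<^sub>1 p, H\<^sub>1 p)) \<and>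
         (\<forall>l h. \<exists>d>0. ((\<lambda>y. g (l, y)) has_real_derivative d) (at h)))"

definition S2 :: "(real^3) set" where
  "S2 = sphere 0 1"

text \<open>The standard area form, oriented by the outward normal.\<close>

definition area_form :: "real^3 \<Rightarrow> real^3 \<Rightarrow> real^3 \<Rightarrow> real" where
  "area_form p u v = p \<bullet> cross3 u v"

text \<open>\<open>a \<omega>\<^sub>S\<^sub>2 \<oplus> b \<omega>\<^sub>S\<^sub>2\<close> on \<open>S2 \<times> S2\<close>.\<close>

definition weighted_area_form ::
  "real \<Rightarrow> real \<Rightarrow> (real^3) \<times> (real^3) \<Rightarrow> (real^3) \<times> (real^3) \<Rightarrow> (real^3) \<times> (real^3) \<Rightarrow> real" where
  "weighted_area_form a b p u v =
     a * area_form (fst p) (fst u) (fst v) + b * area_form (snd p) (snd u) (snd v)"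

text \<open>\<open>x\<^sub>i, y\<^sub>i, z\<^sub>i\<close> are the components 1, 2, 3 of the \<open>i\<close>-th factor.\<close>

definition coupled_angular_momenta ::
  "real \<Rightarrow> real \<Rightarrow> real \<Rightarrow> ((real^3) \<times> (real^3)) system" where
  "coupled_angular_momenta R\<^sub>1 R\<^sub>2 t =
     (S2 \<times> S2,
      (\<lambda>p u v. - weighted_area_form R\<^sub>1 R\<^sub>2 p u v),
      ((\<lambda>(p, q). R\<^sub>1 * (p$3 - 1) + R\<^sub>2 * (q$3 + 1)),
       (\<lambda>(p, q). (1 - t) * p$3 + t * (p$1 * q$1 + p$2 * q$2 + p$3 * q$3) + 2 * t - 1)))"

definition reduced_kepler ::
  "real \<Rightarrow> real \<Rightarrow> ((real^3) \<times> (real^3)) system" where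
  "reduced_kepler n c =
     (S2 \<times> S2,
      (\<lambda>p u v. - n * weighted_area_form 1 1 p u v),
      ((\<lambda>(p, q). n * (p$3 + q$3)),
       (\<lambda>(p, q). (p$1 * q$1 + p$2 * q$2 + p$3 * q$3) + c * (p$3 - q$3))))"

end

theory Submission imports Defs begin

text \<open>
  The symplectomorphism can be taken to be the identity. The two symplectic forms on
  \<open>S2 \<times> S2\<close> coincide when \<open>R\<^sub>1 = R\<^sub>2 = n\<close>, and so do the circle actions, because the shifts
  \<open>- n\<close> and \<open>+ n\<close> in \<open>L\<close> cancel. Both second integrals lie in the span of
  \<open>1\<close>, \<open>z\<^sub>1\<close>, \<open>z\<^sub>2\<close> and the inner product of the two factors. Hence it suffices to find \<open>t\<close> and
  \<open>a\<close> for which \<open>H = t G + a L\<^sub>z + (2 t - 1)\<close>; the inner products then match. The coefficients of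
  \<open>z\<^sub>1\<close> and \<open>z\<^sub>2\<close> match exactly when \<open>t c + a n = 1 - t\<close> and \<open>- t c + a n = 0\<close>, with solution
  \<open>t = 1 / (1 + 2 c)\<close> and \<open>a = t c / n\<close>. Since \<open>c > 0\<close>, this \<open>t\<close> lies in the admissible range and
  is positive, so \<open>g (l, h) = t h + a l + (2 t - 1)\<close> is increasing in \<open>h\<close>.

  What remains is that the identity and affine functions are smooth in the sense of iterated
  Frechet differentiability: the derivative of an affine map in a fixed direction is constant.
\<close>

lemma higher_differentiable_on_const: "higher_differentiable_on U (\<lambda>x. b) k"
  by (induction k arbitrary: b) auto

lemma smooth_on_affine:
  assumes "bounded_linear f"
  shows "smooth_on U (\<lambda>x. f x + b)"
proof -
  have der: "((\<lambda>x. f x + b) has_derivative f) (at x)" for x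
    using assms by (intro has_derivative_add_const bounded_linear_imp_has_derivative)
  then have "frechet_derivative (\<lambda>x. f x + b) (at x) = f" for x
    using frechet_derivative_at by metis
  moreover have "continuous_on U (\<lambda>x. f x + b)"
    using der by (meson continuous_at_imp_continuous_on has_derivative_continuous)
  ultimately have "higher_differentiable_on U (\<lambda>x. f x + b) k" for k
    using der by (cases k) (auto simp: higher_differentiable_on_const differentiable_def)
  then show ?thesis
    by (simp add: smooth_on_def)
qed

text \<open>
  Agreement with the identity is asked for on \<open>M\<close> only, so that this covers \<open>inv_into M (\<lambda>x. x)\<close>,
  whose values outside \<open>M\<close> are arbitrary.
\<close>

lemma smooth_map_cong_id:
  assumes "\<And>x. x \<in> M \<Longrightarrow> f x = x"
  shows "smooth_map M M f"
  unfolding smooth_map_def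
proof (intro conjI ballI)
  show "f ` M \<subseteq> M"
    using assms by auto
  have "smooth_on UNIV (\<lambda>x::'a. x)"
    using smooth_on_affine[OF bounded_linear_ident, of UNIV 0] by simp
  then show "\<exists>U F. open U \<and> p \<in> U \<and> smooth_on U F \<and> (\<forall>x\<in>M \<inter> U. F x = f x)" for p
    using assms by (intro exI[of _ UNIV] exI[of _ "\<lambda>x. x"]) auto
qed

lemma diffeomorphism_ident: "diffeomorphism M M (\<lambda>x. x)"
proof -
  have "smooth_map M M (inv_into M (\<lambda>x. x))"
    by (rule smooth_map_cong_id) (simp add: inv_into_f_eq)
  then show ?thesis
    by (simp add: diffeomorphism_def smooth_map_cong_id bij_betw_def)
qed

lemma symplectomorphism_ident:
  assumes "\<And>p u v. p \<in> M \<Longrightarrow> \<omega>' p u v = \<omega> p u v"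
  shows "symplectomorphism M \<omega> M \<omega>' (\<lambda>x. x)"
  unfolding symplectomorphism_def
  using assms by (auto intro!: diffeomorphism_ident exI[of _ "\<lambda>x. x"])

theorem proposition3p17:
  fixes n c :: real
  assumes "n > 0" and "c > 0"
  shows "\<exists>t\<in>{0..1}. semitoric_isomorphic (reduced_kepler n c) (coupled_angular_momenta n n t)"
proof -
  define t where "t = 1 / (1 + 2 * c)"
  define a where "a = t * c / n"
  define g :: "real \<times> real \<Rightarrow> real" where "g = (\<lambda>x. (t * snd x + a * fst x) + (2 * t - 1))"
  have t: "t > 0" "t \<le> 1" and t_eq: "1 - t = 2 * (t * c)"
    using assms by (auto simp: t_def field_simps)
  have an: "a * n = t * c"
    using assms by (simp add: a_def)
  have "bounded_linear (\<lambda>x::real \<times> real. t * snd x + a * fst x)"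
    by (intro bounded_linear_add bounded_linear_const_mult bounded_linear_fst bounded_linear_snd)
  then have g_smooth: "smooth_on UNIV g"
    unfolding g_def by (rule smooth_on_affine)
  have g_mono: "\<exists>d>0. ((\<lambda>y. g (l, y)) has_real_derivative d) (at h)" for l h
    using t(1) unfolding g_def by (intro exI[of _ t]) (auto intro!: derivative_eq_intros)
  have H_eq: "(1 - t) * z1 + t * s + 2 * t - 1 = g (n * (z1 + z2), s + c * (z1 - z2))"
    for z1 z2 s
  proof -
    have "g (n * (z1 + z2), s + c * (z1 - z2))
        = t * s + (t * c) * (z1 - z2) + (a * n) * (z1 + z2) + (2 * t - 1)"
      by (simp add: g_def algebra_simps)
    then show ?thesis
      unfolding an t_eq by (simp add: algebra_simps)
  qed
  have "symplectomorphism (S2 \<times> S2) (\<lambda>p u v. - n * weighted_area_form 1 1 p u v)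
      (S2 \<times> S2) (\<lambda>p u v. - weighted_area_form n n p u v) (\<lambda>x. x)"
    by (rule symplectomorphism_ident) (simp add: weighted_area_form_def algebra_simps)
  moreover have "n * (z1 - 1) + n * (z2 + 1) = n * (z1 + z2)" for z1 z2
    by (simp add: algebra_simps)
  ultimately have "semitoric_isomorphic (reduced_kepler n c) (coupled_angular_momenta n n t)"
    unfolding semitoric_isomorphic_def reduced_kepler_def coupled_angular_momenta_def prod.case
    using g_smooth g_mono
    by (intro exI[of _ "\<lambda>x. x"] exI[of _ g]) (simp add: H_eq split_beta)
  then show ?thesis
    using t by force
qed

end
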